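(* Let $p$ be a prime number. Then: (1) if $p\neq 2$, then $|\nu_{2p,Z(\mathbb{Z}_{2p})}| = |\nu_p| + p - 1$; (2) if $p\neq 3$, then $|\nu_{3p,Z(\mathbb{Z}_{3p})}| = |\nu_p| + p + \left\lceil\frac{p-1}{2}\right\rceil$.
   Context: For a positive integer $n$, elements of $\mathbb{Z}_n$ are identified with their representatives $0,1,\dots,n-1$. An unordered pair $\{a,b\}$ with $0\le a,b<n$ ($a=b$ allowed) is called a gcd-pair in $\mathbb{Z}_n$ if $\gcd(a,b)$ divides $n$. Here $\gcd(0,a)=a$ and $\gcd(0,0)=0$, so $\{0,0\}$ is not a gcd-pair. $\nu_n$ denotes the set of all gcd-pairs in $\mathbb{Z}_n$, and for $A\subseteq\mathbb{Z}_n$, $\nu_{n,A}$ denotes the set of those gcd-pairs $\{a,b\}\in\nu_n$ with $a,b\in A$. $Z(\mathbb{Z}_n)$ denotes the set of zero divisors of $\mathbb{Z}_n$, where the zero element is not counted as a zero divisor. *)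

theory Defs
  imports "HOL-Number_Theory.Residues"
begin

text \<open>The zero element does not count as a zero divisor. The definition is used only for
  commutative rings, so one side suffices.\<close>

definition zero_divisors :: "('a, 'b) ring_scheme \<Rightarrow> 'a set" where
  "zero_divisors R = {a \<in> carrier R. a \<noteq> \<zero>\<^bsub>R\<^esub> \<and>
     (\<exists>b \<in> carrier R. b \<noteq> \<zero>\<^bsub>R\<^esub> \<and> a \<otimes>\<^bsub>R\<^esub> b = \<zero>\<^bsub>R\<^esub>)}"

text \<open>The carrier of \<open>residue_ring (int n)\<close> consists of the integers from \<open>0\<close> to
  \<open>n - 1\<close>, so \<open>gcd\<close> below is the integer gcd of the representatives.
  The unordered pair of \<open>a\<close> and \<open>b\<close> is the set \<open>{a, b}\<close>, a singleton if \<open>a = b\<close>.\<close>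

definition gcd_pairs_on :: "nat \<Rightarrow> int set \<Rightarrow> int set set" where
  "gcd_pairs_on n A = {{a, b} | a b. a \<in> carrier (residue_ring (int n)) \<inter> A \<and>
     b \<in> carrier (residue_ring (int n)) \<inter> A \<and> gcd a b dvd int n}"

definition gcd_pairs :: "nat \<Rightarrow> int set set" where
  "gcd_pairs n = gcd_pairs_on n (carrier (residue_ring (int n)))"

end

theory Submission
  imports Defs
begin

text \<open>For distinct primes \<open>p\<close> and \<open>q\<close>, a zero divisor modulo \<open>q p\<close> is either \<open>q i\<close> with
  \<open>0 < i < p\<close> or \<open>p j\<close> with \<open>0 < j < q\<close>. As \<open>gcd (q i) (q i') = q gcd i i'\<close> and
  \<open>gcd (q i) (p j) = gcd i j\<close>, in each of the three types of pairs being a gcd-pair amounts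
  to coprimality of the small cofactors. The pairs of the first type match the gcd-pairs
  modulo \<open>p\<close> other than \<open>{0, 1}\<close>, and for \<open>q \<le> 3\<close> the other two types are counted directly.\<close>

section \<open>Gcd-pairs modulo a prime\<close>

definition coprime_pairs :: "int \<Rightarrow> int set set" where
  "coprime_pairs m = {{a, b} | a b. a \<in> {1..<m} \<and> b \<in> {1..<m} \<and> coprime a b}"

lemma finite_coprime_pairs: "finite (coprime_pairs m)"
proof -
  have "coprime_pairs m \<subseteq> Pow {1..<m}"
    by (auto simp: coprime_pairs_def)
  then show ?thesis
    by (rule finite_subset) simp
qed

lemma coprime_prime_of_less:
  fixes p i :: int
  assumes "prime p" "i \<in> {1..<p}"
  shows "coprime p i"
  using assms by (auto intro!: prime_imp_coprime dest: zdvd_imp_le)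

text \<open>\<open>gcd a b\<close> divides \<open>a\<close>, which is coprime to \<open>p\<close>,
  so if it also divides \<open>p\<close> it is a unit. The entry \<open>b\<close> is left free so
  that the pair with \<open>b = 0\<close> is covered too.\<close>

lemma gcd_dvd_prime_iff_coprime:
  fixes p a b :: int
  assumes "prime p" "a \<in> {1..<p}"
  shows "gcd a b dvd p \<longleftrightarrow> coprime a b"
proof
  assume "gcd a b dvd p"
  then have "gcd a b dvd gcd p a" by simp
  then have "gcd a b dvd 1"
    using coprime_prime_of_less[OF assms] by (simp only: coprime_iff_gcd_eq_1)
  then show "coprime a b"
    by (simp add: coprime_iff_gcd_eq_1)
qed (simp add: coprime_iff_gcd_eq_1)

text \<open>For two nonzero entries, dividing \<open>p\<close> amounts to coprimality. A pair
  \<open>{0, a}\<close> has gcd \<open>a\<close>, and the only divisor of \<open>p\<close> among 1,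
  ..., \<open>p - 1\<close> is 1; the pair \<open>{0, 0}\<close> has gcd 0. So the entry 0
  contributes exactly one gcd-pair.\<close>

lemma gcd_pairs_prime_eq:
  assumes "prime p"
  shows "gcd_pairs p = insert {0, 1} (coprime_pairs (int p))"
proof -
  have P: "prime (int p)" and p2: "int p \<ge> 2"
    using assms prime_ge_2_nat by auto
  have carrier: "carrier (residue_ring (int p)) = insert 0 {1..<int p}"
    using p2 by (auto simp: residue_ring_def)
  have zero: "a dvd int p \<longleftrightarrow> a = 1" if "a \<in> {1..<int p}" for a
    using gcd_dvd_prime_iff_coprime[OF P that, of 0] that by auto
  show ?thesis
  proof (intro equalityI subsetI)
    fix S assume "S \<in> gcd_pairs p"
    then obtain a b where S: "S = {a, b}" "a \<in> insert 0 {1..<int p}" "b \<in> insert 0 {1..<int p}"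
      "gcd a b dvd int p"
      by (auto simp: gcd_pairs_def gcd_pairs_on_def carrier)
    consider "a = 0" "b = 0" | "a = 0" "b \<in> {1..<int p}" | "a \<in> {1..<int p}" "b = 0"
      | "a \<in> {1..<int p}" "b \<in> {1..<int p}"
      using S by blast
    then show "S \<in> insert {0, 1} (coprime_pairs (int p))"
    proof cases
      case 1
      then show ?thesis using S p2 by simp
    next
      case 2
      then show ?thesis using S zero[of b] by auto
    next
      case 3
      then show ?thesis using S zero[of a] by auto
    next
      case 4
      then show ?thesis
        using S gcd_dvd_prime_iff_coprime[OF P] by (auto simp: coprime_pairs_def)
    qed
  next
    fix S assume "S \<in> insert {0, 1} (coprime_pairs (int p))"
    then consider "S = {0, 1}"
      | a b where "S = {a, b}" "a \<in> {1..<int p}" "b \<in> {1..<int p}" "coprime a b"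
      by (auto simp: coprime_pairs_def)
    then show "S \<in> gcd_pairs p"
    proof cases
      case 1
      moreover have "gcd 0 1 dvd int p" "1 \<in> insert 0 {1..<int p}" using p2 by auto
      ultimately show ?thesis
        unfolding gcd_pairs_def gcd_pairs_on_def carrier by blast
    next
      case 2
      then have "gcd a b dvd int p" by (simp add: coprime_iff_gcd_eq_1)
      then show ?thesis
        unfolding gcd_pairs_def gcd_pairs_on_def carrier using 2 by blast
    qed
  qed
qed

lemma card_gcd_pairs_prime:
  assumes "prime p"
  shows "card (gcd_pairs p) = Suc (card (coprime_pairs (int p)))"
proof -
  have "{0, 1} \<notin> coprime_pairs (int p)"
    by (auto simp: coprime_pairs_def doubleton_eq_iff)
  then show ?thesis
    by (simp add: gcd_pairs_prime_eq[OF assms] finite_coprime_pairs)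
qed

section \<open>Zero divisors of the residue ring\<close>

lemma zero_divisors_residue_ring:
  assumes "m > 1"
  shows "zero_divisors (residue_ring m) = {a \<in> {1..<m}. \<not> coprime a m}"
proof (intro equalityI subsetI)
  fix a assume "a \<in> zero_divisors (residue_ring m)"
  then obtain b where b: "0 \<le> a" "a < m" "a \<noteq> 0" "0 \<le> b" "b < m" "b \<noteq> 0" "m dvd a * b"
    by (auto simp: zero_divisors_def residue_ring_def)
  then have *: "a \<in> {1..<m}" "b \<in> {1..<m}" "m dvd a * b" by auto
  have "\<not> coprime a m"
  proof
    assume "coprime a m"
    with * have "m dvd b"
      by (simp add: coprime_dvd_mult_right_iff coprime_commute)
    then show False using * by (auto dest: zdvd_imp_le)
  qed
  then show "a \<in> {a \<in> {1..<m}. \<not> coprime a m}" using * by simp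
next
  fix a assume a: "a \<in> {a \<in> {1..<m}. \<not> coprime a m}"
  \<comment> \<open>The cofactor \<open>m / g\<close> annihilates \<open>a\<close>, because
    \<open>a\<close> is a multiple of \<open>g\<close>; it is a nonzero residue because
    \<open>g > 1\<close> keeps it below \<open>m\<close>.\<close>
  define g where "g = gcd a m"
  have "g > 0" "g \<noteq> 1" using a by (auto simp: g_def coprime_iff_gcd_eq_1)
  obtain c where c: "a = g * c" unfolding g_def by (meson dvdE gcd_dvd1)
  obtain b where b: "m = g * b" unfolding g_def by (meson dvdE gcd_dvd2)
  have "b > 0" using b \<open>g > 0\<close> assms zero_less_mult_pos[of g b] by linarith
  moreover have "b < m" using b \<open>g > 0\<close> \<open>g \<noteq> 1\<close> \<open>b > 0\<close> by simp
  moreover have "m dvd a * b" using b c by simp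
  ultimately show "a \<in> zero_divisors (residue_ring m)"
    using a by (auto simp: zero_divisors_def residue_ring_def intro!: bexI[of _ b])
qed

text \<open>A number shares a factor with \<open>q * p\<close> exactly if one of the two primes
  divides it, and the bounds \<open>1 \<le> a < q * p\<close> turn into the bounds on the
  cofactor.\<close>

lemma zero_divisors_residue_ring_prime_mult:
  fixes p q :: int
  assumes "prime p" "prime q"
  shows "zero_divisors (residue_ring (q * p)) = (*) q ` {1..<p} \<union> (*) p ` {1..<q}"
proof -
  have p: "p > 1" and q: "q > 1" using assms prime_gt_1_int by auto
  have "q * p > 1" using p q by (simp add: less_1_mult)
  note zd = zero_divisors_residue_ring[OF this]
  show ?thesis
  proof (intro equalityI subsetI)
    fix a assume "a \<in> zero_divisors (residue_ring (q * p))"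
    then have a: "1 \<le> a" "a < q * p" "\<not> coprime a (q * p)" by (auto simp: zd)
    then have "\<not> coprime q a \<or> \<not> coprime p a"
      by (simp add: coprime_commute)
    then have "q dvd a \<or> p dvd a"
      using assms by (meson prime_imp_coprime)
    then show "a \<in> (*) q ` {1..<p} \<union> (*) p ` {1..<q}"
    proof
      assume "q dvd a"
      then obtain i where i: "a = q * i" by blast
      have "i > 0" using a(1) i q by (metis int_one_le_iff_zero_less zero_less_mult_pos less_trans zero_less_one)
      moreover have "i < p" using a(2) i q by simp
      ultimately show ?thesis using i by auto
    next
      assume "p dvd a"
      then obtain i where i: "a = p * i" by blast
      have "i > 0" using a(1) i p by (metis int_one_le_iff_zero_less zero_less_mult_pos less_trans zero_less_one)
      moreover have "i < q" using a(2) i p by (simp add: mult.commute[of q])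
      ultimately show ?thesis using i by auto
    qed
  next
    fix a assume "a \<in> (*) q ` {1..<p} \<union> (*) p ` {1..<q}"
    then consider i where "a = q * i" "i \<in> {1..<p}" | j where "a = p * j" "j \<in> {1..<q}"
      by blast
    then show "a \<in> zero_divisors (residue_ring (q * p))"
    proof cases
      case 1
      have "q * i > 0" using 1 q by simp
      then have "q * i \<ge> 1" by linarith
      moreover have "\<not> coprime (q * i) (q * p)" using q by simp
      ultimately show ?thesis using 1 q by (simp add: zd)
    next
      case 2
      have "p * j > 0" using 2 p by simp
      then have "p * j \<ge> 1" by linarith
      moreover have "\<not> coprime (p * j) (q * p)" using p by simp
      moreover have "p * j < q * p" using 2 p by (simp add: mult.commute[of q])
      ultimately show ?thesis using 2 by (simp add: zd)
    qed
  qed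
qed

section \<open>Gcd-pairs of zero divisors modulo a product of two primes\<close>

lemma gcd_cross_dvd_iff_coprime:
  fixes p q i j :: int
  assumes "prime p" "prime q" "p \<noteq> q" "i \<in> {1..<p}" "j \<in> {1..<q}"
  shows "gcd (q * i) (p * j) dvd q * p \<longleftrightarrow> coprime i j"
proof -
  have pi: "coprime p i" and qj: "coprime q j"
    using assms coprime_prime_of_less by auto
  have pq: "coprime p q" using assms primes_coprime by blast
  \<comment> \<open>The factor \<open>q\<close> is coprime to \<open>p * j\<close> and
    \<open>p\<close> is coprime to \<open>i\<close>, so both cancel.\<close>
  have eq: "gcd (q * i) (p * j) = gcd i j"
    using pi qj pq
    by (simp add: gcd_mult_left_left_cancel gcd_mult_right_left_cancel coprime_commute)
  have "coprime i j" if "gcd i j dvd q * p"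
  proof -
    \<comment> \<open>The gcd divides \<open>j\<close>, hence has no factor \<open>q\<close>;
      dividing \<open>q * p\<close> then reduces to dividing \<open>p\<close>.\<close>
    have "coprime (gcd i j) q"
      using qj by (meson coprime_commute coprime_divisors dvd_refl gcd_dvd2)
    then have "gcd i j dvd p" using that by (simp add: coprime_dvd_mult_right_iff)
    then show ?thesis using gcd_dvd_prime_iff_coprime assms by blast
  qed
  then show ?thesis unfolding eq by (metis coprime_iff_gcd_eq_1 one_dvd)
qed

text \<open>The common factor \<open>q\<close> comes out of the gcd and cancels against that of
  \<open>q * p\<close>, which leaves the criterion modulo \<open>p\<close>.\<close>

lemma gcd_scaled_dvd_iff_coprime:
  fixes p q i j :: int
  assumes "prime p" "q > 0" "i \<in> {1..<p}"
  shows "gcd (q * i) (q * j) dvd q * p \<longleftrightarrow> coprime i j"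
proof -
  have "gcd (q * i) (q * j) = q * gcd i j"
    using gcd_mult_distrib_int[of q i j] \<open>q > 0\<close> by simp
  then show ?thesis
    using gcd_dvd_prime_iff_coprime[OF assms(1,3)] \<open>q > 0\<close> by simp
qed

text \<open>The three sets hold the pairs of two multiples of \<open>q\<close>, of two multiples of
  \<open>p\<close>, and of one of each. The mixed pairs are indexed by ordered
  \<open>(i, j)\<close>, since the prime factor of an entry fixes its role.\<close>

lemma gcd_pairs_on_zero_divisors_eq:
  assumes "prime p" "prime q" "p \<noteq> q"
  shows "gcd_pairs_on (q * p) (zero_divisors (residue_ring (int (q * p)))) =
    (`) ((*) (int q)) ` coprime_pairs (int p) \<union>
    (`) ((*) (int p)) ` coprime_pairs (int q) \<union>
    (\<lambda>(i, j). {int q * i, int p * j}) `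
      {(i, j). i \<in> {1..<int p} \<and> j \<in> {1..<int q} \<and> coprime i j}"
    (is "?L = ?A \<union> ?B \<union> ?C")
proof -
  let ?p = "int p" and ?q = "int q"
  let ?Z = "zero_divisors (residue_ring (?q * ?p))"
  have P: "prime ?p" "prime ?q" "?p \<noteq> ?q" using assms by auto
  have pos: "?p > 0" "?q > 0" using assms prime_gt_0_nat by auto
  note Z = zero_divisors_residue_ring_prime_mult[OF P(1,2)]
  note iffs = gcd_scaled_dvd_iff_coprime[OF P(1) pos(2)]
    gcd_scaled_dvd_iff_coprime[OF P(2) pos(1), unfolded mult.commute[of ?p ?q]]
    gcd_cross_dvd_iff_coprime[OF P]
  have L: "?L = {{a, b} | a b. a \<in> ?Z \<and> b \<in> ?Z \<and> gcd a b dvd ?q * ?p}"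
    unfolding gcd_pairs_on_def by (auto simp: zero_divisors_def)
  show ?thesis
  proof (intro equalityI subsetI)
    fix S assume "S \<in> ?L"
    then obtain a b where S: "S = {a, b}" "a \<in> ?Z" "b \<in> ?Z" "gcd a b dvd ?q * ?p"
      unfolding L by blast
    \<comment> \<open>Three cases suffice instead of four: since \<open>S\<close> is unordered, a
      mixed pair can be written with the multiple of \<open>q\<close> first.\<close>
    consider i j where "i \<in> {1..<?p}" "j \<in> {1..<?p}" "a = ?q * i" "b = ?q * j"
      | i j where "i \<in> {1..<?q}" "j \<in> {1..<?q}" "a = ?p * i" "b = ?p * j"
      | i j where "i \<in> {1..<?p}" "j \<in> {1..<?q}" "S = {?q * i, ?p * j}"
          "gcd (?q * i) (?p * j) dvd ?q * ?p"
      using S unfolding Z by (auto simp: gcd.commute insert_commute)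
    then show "S \<in> ?A \<union> ?B \<union> ?C"
    proof cases
      case 1
      then have "{i, j} \<in> coprime_pairs ?p"
        using S(4) iffs(1) unfolding coprime_pairs_def by blast
      moreover have "S = (*) ?q ` {i, j}" using 1 S by simp
      ultimately show ?thesis by blast
    next
      case 2
      then have "coprime i j" using S(4) iffs(2)[of i j] by (simp add: mult.commute)
      then have "{i, j} \<in> coprime_pairs ?q"
        using 2 unfolding coprime_pairs_def by blast
      moreover have "S = (*) ?p ` {i, j}" using 2 S by simp
      ultimately show ?thesis by blast
    next
      case 3
      then have "(i, j) \<in> {(i, j). i \<in> {1..<?p} \<and> j \<in> {1..<?q} \<and> coprime i j}"
        using iffs(3) by blast
      then show ?thesis using 3 by blast
    qed
  next
    fix S assume "S \<in> ?A \<union> ?B \<union> ?C"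
    then consider i j where "i \<in> {1..<?p}" "j \<in> {1..<?p}" "coprime i j" "S = {?q * i, ?q * j}"
      | i j where "i \<in> {1..<?q}" "j \<in> {1..<?q}" "coprime i j" "S = {?p * i, ?p * j}"
      | i j where "i \<in> {1..<?p}" "j \<in> {1..<?q}" "coprime i j" "S = {?q * i, ?p * j}"
      by (auto simp: coprime_pairs_def)
    then show "S \<in> ?L"
    proof cases
      case 1
      then show ?thesis unfolding L Z using iffs(1)[of i j] by blast
    next
      case 2
      then have "gcd (?p * i) (?p * j) dvd ?q * ?p"
        using iffs(2)[of i j] by (simp add: mult.commute)
      then show ?thesis unfolding L Z using 2 by blast
    next
      case 3
      then show ?thesis unfolding L Z using iffs(3)[of i j] by blast
    qed
  qed
qed

text \<open>Each of the three parametrizations is injective and their images are disjoint, so the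
  cardinalities add up.\<close>

lemma card_gcd_pairs_on_zero_divisors:
  assumes "prime p" "prime q" "p \<noteq> q"
  shows "card (gcd_pairs_on (q * p) (zero_divisors (residue_ring (int (q * p))))) =
    card (coprime_pairs (int p)) + card (coprime_pairs (int q)) +
    card {(i, j). i \<in> {1..<int p} \<and> j \<in> {1..<int q} \<and> coprime i j}"
proof -
  let ?p = "int p" and ?q = "int q"
  let ?M = "{(i, j). i \<in> {1..<?p} \<and> j \<in> {1..<?q} \<and> coprime i j}"
  let ?f = "\<lambda>(i, j). {?q * i, ?p * j}"
  let ?A = "(`) ((*) ?q) ` coprime_pairs ?p" and ?B = "(`) ((*) ?p) ` coprime_pairs ?q"
  have P: "prime ?p" "prime ?q" "?p \<noteq> ?q" using assms by auto
  have pos: "?p > 0" "?q > 0" using assms prime_gt_0_nat by auto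
  \<comment> \<open>Otherwise \<open>p\<close> would divide \<open>q * i\<close>, although it is
    coprime to both factors. Here \<open>j\<close> may be any integer.\<close>
  have ne: "?q * i \<noteq> ?p * j" if "i \<in> {1..<?p}" for i j
  proof
    assume "?q * i = ?p * j"
    then have "?p dvd ?q * i" by simp
    moreover have "coprime ?p (?q * i)"
      using coprime_prime_of_less[OF P(1) that] primes_coprime[OF P] by simp
    ultimately show False
      using P(1) by (metis coprime_absorb_left not_prime_unit)
  qed
  have inj: "inj_on ((`) ((*) c)) X" if "c > 0" for c :: int and X
    using that by (intro inj_on_image) (auto simp: inj_on_def)
  have "finite ?M"
    by (rule finite_subset[of _ "{1..<?p} \<times> {1..<?q}"]) auto
  have "inj_on ?f ?M"
  proof (rule inj_onI)
    fix x y assume x: "x \<in> ?M" and y: "y \<in> ?M" and eq: "?f x = ?f y"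
    obtain i j i' j' where xy: "x = (i, j)" "y = (i', j')" by fastforce
    have "i \<in> {1..<?p}" "i' \<in> {1..<?p}" using x y xy by simp_all
    \<comment> \<open>Equality of the two sets also allows a crosswise match such as
      \<open>q * i = p * j'\<close>; this is what \<open>ne\<close> excludes.\<close>
    then have "?q * i = ?q * i' \<and> ?p * j = ?p * j'"
      using eq ne[of i j'] ne[of i' j] unfolding xy by (simp add: doubleton_eq_iff)
    then show "x = y" using pos xy by simp
  qed
  then have cM: "card (?f ` ?M) = card ?M" by (rule card_image)
  have cA: "card ?A = card (coprime_pairs ?p)" and cB: "card ?B = card (coprime_pairs ?q)"
    using pos by (simp_all only: card_image[OF inj])
  \<comment> \<open>The disjoint sets \<open>?Q\<close> and \<open>?P\<close> tell the kinds apart: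
    members of \<open>?A\<close> lie inside \<open>?Q\<close>, members of \<open>?B\<close> inside
    \<open>?P\<close>, and mixed pairs meet both. To separate \<open>?A\<close> from
    \<open>?B\<close>, nonemptiness matters, as the empty set would lie in both.\<close>
  let ?Q = "(*) ?q ` {1..<?p}" and ?P = "range ((*) ?p)"
  have QP: "?Q \<inter> ?P = {}" using ne by blast
  have A: "S \<subseteq> ?Q \<and> S \<noteq> {}" if "S \<in> ?A" for S
    using that unfolding coprime_pairs_def by blast
  have B: "S \<subseteq> ?P" if "S \<in> ?B" for S
    using that unfolding coprime_pairs_def by blast
  have C: "S \<inter> ?Q \<noteq> {} \<and> S \<inter> ?P \<noteq> {}" if "S \<in> ?f ` ?M" for S
    using that by auto
  have AB: "?A \<inter> ?B = {}"
  proof (rule equals0I)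
    fix S assume "S \<in> ?A \<inter> ?B"
    then have "S \<in> ?A" "S \<in> ?B" by (rule IntD1, rule IntD2)
    then show False using A[of S] B[of S] QP by blast
  qed
  have ABC: "(?A \<union> ?B) \<inter> ?f ` ?M = {}"
  proof (rule equals0I)
    fix S assume "S \<in> (?A \<union> ?B) \<inter> ?f ` ?M"
    then have S: "S \<in> ?A \<union> ?B" "S \<inter> ?Q \<noteq> {}" "S \<inter> ?P \<noteq> {}"
      using C[of S] by (simp_all only: Int_iff simp_thms)
    from S(1) have "S \<subseteq> ?Q \<or> S \<subseteq> ?P"
      using A[of S] B[of S] by (simp only: Un_iff) argo
    then show False
      using S(2,3) QP by (elim disjE) (metis Int_mono order_refl subset_empty inf_commute)+
  qed
  have fin: "finite ?A" "finite ?B" "finite (?f ` ?M)"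
    using \<open>finite ?M\<close> by (simp_all only: finite_imageI finite_coprime_pairs)
  have "card (?A \<union> ?B \<union> ?f ` ?M) = card (?A \<union> ?B) + card (?f ` ?M)"
    by (rule card_Un_disjoint[OF finite_UnI[OF fin(1,2)] fin(3) ABC])
  also have "card (?A \<union> ?B) = card ?A + card ?B"
    by (rule card_Un_disjoint[OF fin(1,2) AB])
  finally have "card (?A \<union> ?B \<union> ?f ` ?M) = card ?A + card ?B + card (?f ` ?M)" .
  then show ?thesis
    by (simp only: gcd_pairs_on_zero_divisors_eq[OF assms] cA cB cM)
qed

section \<open>Explicit counts for the factors 2 and 3\<close>

lemma coprime_pairs_2: "coprime_pairs 2 = {{1}}"
proof -
  have "{1..<2::int} = {1}" by auto
  then show ?thesis by (auto simp: coprime_pairs_def)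
qed

lemma coprime_pairs_3: "coprime_pairs 3 = {{1}, {1, 2}}"
proof -
  have *: "{1..<3::int} = {1, 2}" by auto
  have "{1} \<in> coprime_pairs 3"
    unfolding coprime_pairs_def * using coprime_1_left[of 1] by blast
  moreover have "{1, 2} \<in> coprime_pairs 3"
    unfolding coprime_pairs_def * using coprime_1_left[of 2] by blast
  moreover have "coprime_pairs 3 \<subseteq> {{1}, {1, 2}}"
    unfolding coprime_pairs_def * by auto
  ultimately show ?thesis by blast
qed

text \<open>Used to count the cofactors \<open>i\<close> that are coprime to 2. Writing
  \<open>i = 2 * k + 1\<close>, the bound \<open>i < n\<close> becomes
  \<open>k < n div 2\<close>.\<close>

lemma card_odd_less: "card {i \<in> {1..<int n}. odd i} = n div 2"
proof -
  have "{i \<in> {1..<int n}. odd i} = (\<lambda>k. 2 * int k + 1) ` {..<n div 2}"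
  proof (intro equalityI subsetI)
    fix i assume i: "i \<in> {i \<in> {1..<int n}. odd i}"
    then obtain k where k: "i = 2 * k + 1" by (auto elim: oddE)
    with i have "i = 2 * int (nat k) + 1" "nat k < n div 2" by auto
    then show "i \<in> (\<lambda>k. 2 * int k + 1) ` {..<n div 2}" by blast
  qed auto
  then show ?thesis by (simp add: card_image inj_on_def)
qed

theorem corollary3p8:
  fixes p :: nat
  assumes "prime p"
  shows "(p \<noteq> 2 \<longrightarrow>
           int (card (gcd_pairs_on (2 * p) (zero_divisors (residue_ring (int (2 * p))))))
             = int (card (gcd_pairs p)) + int p - 1)
       \<and> (p \<noteq> 3 \<longrightarrow>
           int (card (gcd_pairs_on (3 * p) (zero_divisors (residue_ring (int (3 * p))))))
             = int (card (gcd_pairs p)) + int p + \<lceil>(real p - 1) / 2\<rceil>)"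
proof (intro conjI impI)
  have p2: "p \<ge> 2" using assms prime_ge_2_nat by blast
  {
    assume "p \<noteq> 2"
    \<comment> \<open>The only multiple of \<open>p\<close> among the zero divisors is
      \<open>p\<close> itself, so \<open>j = 1\<close>, which is coprime to every
      \<open>i\<close>.\<close>
    have "{(i, j). i \<in> {1..<int p} \<and> j \<in> {1..<int 2} \<and> coprime i j} = {1..<int p} \<times> {1}"
      by auto
    then have "card {(i, j). i \<in> {1..<int p} \<and> j \<in> {1..<int 2} \<and> coprime i j} = p - 1"
      by (simp add: card_cartesian_product)
    \<comment> \<open>The single pair in \<open>coprime_pairs 2\<close> makes up for
      \<open>{0, 1}\<close>, which is counted in \<open>gcd_pairs p\<close> but has no counterpart
      among the zero divisors.\<close>
    then show "int (card (gcd_pairs_on (2 * p) (zero_divisors (residue_ring (int (2 * p))))))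
             = int (card (gcd_pairs p)) + int p - 1"
      using card_gcd_pairs_on_zero_divisors[OF assms two_is_prime_nat \<open>p \<noteq> 2\<close>] p2
      by (simp add: card_gcd_pairs_prime[OF assms] coprime_pairs_2)
  }
  {
    assume "p \<noteq> 3"
    have prime3: "prime (3::nat)" by simp
    have three: "int 3 = 3" by simp
    have *: "{1..<3::int} = {1, 2}" by auto
    \<comment> \<open>Every \<open>i\<close> is coprime to \<open>j = 1\<close>, and exactly the odd
      ones are coprime to \<open>j = 2\<close>.\<close>
    have "{(i, j). i \<in> {1..<int p} \<and> j \<in> {1..<int 3} \<and> coprime i j} =
        {1..<int p} \<times> {1} \<union> {i \<in> {1..<int p}. odd i} \<times> {2}"
      unfolding three * by auto
    moreover have "card ({1..<int p} \<times> {1::int} \<union> {i \<in> {1..<int p}. odd i} \<times> {2}) =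
        card ({1..<int p} \<times> {1::int}) + card ({i \<in> {1..<int p}. odd i} \<times> {2::int})"
    proof (rule card_Un_disjoint)
      have "finite {i \<in> {1..<int p}. odd i}"
        by (rule finite_subset[of _ "{1..<int p}"]) auto
      then show "finite ({i \<in> {1..<int p}. odd i} \<times> {2::int})"
        by (rule finite_cartesian_product) simp
    qed auto
    ultimately have
      "card {(i, j). i \<in> {1..<int p} \<and> j \<in> {1..<int 3} \<and> coprime i j} = p - 1 + p div 2"
      using card_odd_less[of p] by (simp add: card_cartesian_product)
    moreover have "card (coprime_pairs 3) = 2"
      by (simp add: coprime_pairs_3 doubleton_eq_iff)
    \<comment> \<open>For odd \<open>p\<close> the quotient is already the integer
      \<open>p div 2\<close>; for even \<open>p\<close>, that is \<open>p = 2\<close>, it lies one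
      half below and is rounded up.\<close>
    moreover have "\<lceil>(real p - 1) / 2\<rceil> = int (p div 2)"
    proof (rule ceiling_unique)
      have "p = 2 * (p div 2) \<or> p = 2 * (p div 2) + 1" by presburger
      then have "real p = 2 * real (p div 2) \<or> real p = 2 * real (p div 2) + 1"
        by linarith
      then show "real_of_int (int (p div 2)) - 1 < (real p - 1) / 2"
        and "(real p - 1) / 2 \<le> real_of_int (int (p div 2))"
        by auto
    qed
    ultimately show
      "int (card (gcd_pairs_on (3 * p) (zero_divisors (residue_ring (int (3 * p))))))
             = int (card (gcd_pairs p)) + int p + \<lceil>(real p - 1) / 2\<rceil>"
      using card_gcd_pairs_on_zero_divisors[OF assms prime3 \<open>p \<noteq> 3\<close>] p2
      by (simp add: card_gcd_pairs_prime[OF assms])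
  }
qed

end
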